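(* Let $X$ be a real normed space, let $f:X\to\mathbb{R}$ be a real-valued function, and let $\Sigma^+_{Lip}(f)$ be the family of all minimal convex majorants of $f$ that are Lipschitz continuous on $X$. Then $\Sigma^+_{Lip}(f)\neq\varnothing$ if and only if $f$ is Lipschitz bounded from above on $X$.
   Context: $\overline{\mathbb{R}}=\mathbb{R}\cup\{\pm\infty\}$. A function $g:X\to\overline{\mathbb{R}}$ is convex if $g(x)>-\infty$ for all $x\in X$ and its epigraph $\{(x,\alpha)\in X\times\mathbb{R}: g(x)\le\alpha\}$ is a nonempty convex set. A convex majorant of $f$ is a convex function $g:X\to\overline{\mathbb{R}}$ with $f\le g$ pointwise on $X$; a minimal convex majorant of $f$ is a convex majorant that is minimal, for the pointwise ordering, among all convex majorants of $f$. Members of $\Sigma^+_{Lip}(f)$ are real-valued and Lipschitz continuous on the whole of $X$ (with Lipschitz constant possibly depending on the member). $f$ is Lipschitz bounded from above on $X$ if there is a function $\psi:X\to\mathbb{R}$, Lipschitz continuous on $X$, with $f(x)\le\psi(x)$ for all $x\in X$. *)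

theory Defs
  imports "HOL-Analysis.Analysis"
begin

definition ereal_epigraph :: "('a \<Rightarrow> ereal) \<Rightarrow> ('a \<times> real) set" where
  "ereal_epigraph g = {(x, \<alpha>). g x \<le> ereal \<alpha>}"

(* Nonemptiness of the epigraph excludes the constant function \<infinity>. *)
definition convex_ereal_fun :: "('a::real_vector \<Rightarrow> ereal) \<Rightarrow> bool" where
  "convex_ereal_fun g \<longleftrightarrow>
     (\<forall>x. g x > -\<infinity>) \<and> ereal_epigraph g \<noteq> {} \<and> convex (ereal_epigraph g)"

definition convex_majorant :: "('a::real_vector \<Rightarrow> real) \<Rightarrow> ('a \<Rightarrow> ereal) \<Rightarrow> bool" where
  "convex_majorant f g \<longleftrightarrow> convex_ereal_fun g \<and> (\<forall>x. ereal (f x) \<le> g x)"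

(* Minimality is taken among all extended-real-valued convex majorants, not only the
   Lipschitz or the finite ones; the order on functions is the pointwise one. *)
definition minimal_convex_majorant :: "('a::real_vector \<Rightarrow> real) \<Rightarrow> ('a \<Rightarrow> ereal) \<Rightarrow> bool" where
  "minimal_convex_majorant f g \<longleftrightarrow>
     convex_majorant f g \<and> (\<forall>h. convex_majorant f h \<and> h \<le> g \<longrightarrow> h = g)"

definition lipschitz_fun :: "('a::real_normed_vector \<Rightarrow> real) \<Rightarrow> bool" where
  "lipschitz_fun \<phi> \<longleftrightarrow> (\<exists>L. L-lipschitz_on UNIV \<phi>)"

(* Members are real-valued; they are identified with their embeddings into the
   extended reals, where minimality is expressed. *)
definition Sigma_Lip_plus :: "('a::real_normed_vector \<Rightarrow> real) \<Rightarrow> ('a \<Rightarrow> real) set" where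
  "Sigma_Lip_plus f =
     {g. minimal_convex_majorant f (\<lambda>x. ereal (g x)) \<and> lipschitz_fun g}"

definition lipschitz_bounded_above :: "('a::real_normed_vector \<Rightarrow> real) \<Rightarrow> bool" where
  "lipschitz_bounded_above f \<longleftrightarrow> (\<exists>\<psi>. lipschitz_fun \<psi> \<and> (\<forall>x. f x \<le> \<psi> x))"

end

theory Submission
  imports Defs
begin

text \<open>If \<open>f\<close> is dominated by a Lipschitz function, it is dominated by the convex function
  \<open>x \<mapsto> c + L * norm x\<close>, and Zorn's lemma yields a minimal convex majorant below the latter
  (pointwise infima of chains of convex functions are convex). A finite convex function lying below
  \<open>c + L * norm x\<close> is automatically \<open>L\<close>-Lipschitz, because its slopes along a ray are nondecreasing
  and eventually bounded by \<open>L\<close>.\<close>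

lemma lipschitz_on_of_convex_le_norm:
  fixes g :: "'a::real_normed_vector \<Rightarrow> real"
  assumes cvx: "convex_on UNIV g" and le: "\<And>x. g x \<le> c + L * norm x" and L: "0 \<le> L"
  shows "L-lipschitz_on UNIV g"
proof -
  have slope: "g y - g x \<le> L * norm (y - x)" for x y
  proof (rule field_le_epsilon)
    fix e :: real
    assume e: "0 < e"
    \<comment> \<open>The ray from \<open>x\<close> through \<open>y\<close> is followed to a far
      point \<open>z\<close>. Taking \<open>t\<close> at least 1 puts \<open>y\<close> on the
      segment from \<open>x\<close> to \<open>z\<close>; taking it at least \<open>B / e\<close>
      makes the constant excess \<open>B\<close>, once divided by \<open>t\<close>, cost at most
      \<open>e\<close>.\<close>
    define B where "B = c + L * norm x - g x"
    define t where "t = max 1 (B / e)"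
    have t: "1 \<le> t" "B \<le> e * t"
      using e by (auto simp: t_def max_def field_simps)
    define z where "z = x + t *\<^sub>R (y - x)"
    have "y = (1 - 1 / t) *\<^sub>R x + (1 / t) *\<^sub>R z"
      using t by (simp add: z_def algebra_simps)
    then have "g y \<le> (1 - 1 / t) * g x + (1 / t) * g z"
      using convex_onD[OF cvx, of "1 / t" x z] t by simp
    then have "t * g y \<le> t * ((1 - 1 / t) * g x + (1 / t) * g z)"
      using t by (intro mult_left_mono) auto
    also have "\<dots> = (t - 1) * g x + g z"
      using t by (simp add: field_simps)
    finally have 1: "t * (g y - g x) \<le> g z - g x"
      by (simp add: algebra_simps)
    have "norm z \<le> norm x + t * norm (y - x)"
      using norm_triangle_ineq[of x "t *\<^sub>R (y - x)"] t by (simp add: z_def)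
    then have "L * norm z \<le> L * (norm x + t * norm (y - x))"
      using L by (rule mult_left_mono)
    then have "g z - g x \<le> B + t * (L * norm (y - x))"
      using le[of z] by (simp add: B_def algebra_simps)
    with 1 t have "t * (g y - g x) \<le> t * (L * norm (y - x) + e)"
      by (simp add: algebra_simps)
    then show "g y - g x \<le> L * norm (y - x) + e"
      using t by simp
  qed
  show ?thesis
  proof (rule lipschitz_onI)
    fix x y :: 'a
    show "dist (g x) (g y) \<le> L * dist x y"
      using slope[of x y] slope[of y x] by (simp add: dist_norm norm_minus_commute abs_le_iff)
  qed (rule L)
qed

text \<open>Infima of convex functions need not be convex. In a chain, near-minimizers chosen
  separately at \<open>x\<close> and \<open>y\<close> are comparable, so the smaller one is nearly
  minimal at both points, and its convexity inequality passes to the infimum.\<close>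

lemma convex_on_INF_chain:
  fixes C :: "('a::real_vector \<Rightarrow> real) set"
  assumes ne: "C \<noteq> {}" and cvx: "\<And>g. g \<in> C \<Longrightarrow> convex_on UNIV g"
    and chain: "\<And>g h. g \<in> C \<Longrightarrow> h \<in> C \<Longrightarrow> g \<le> h \<or> h \<le> g"
    and bdd: "\<And>x. bdd_below ((\<lambda>g. g x) ` C)"
  shows "convex_on UNIV (\<lambda>x. INF g\<in>C. g x)"
proof (rule convex_onI)
  fix t :: real and x y :: 'a
  assume t: "0 < t" "t < 1"
  let ?u = "\<lambda>x. INF g\<in>C. g x"
  show "?u ((1 - t) *\<^sub>R x + t *\<^sub>R y) \<le> (1 - t) * ?u x + t * ?u y"
  proof (rule field_le_epsilon)
    fix e :: real
    assume e: "0 < e"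
    obtain g1 where g1: "g1 \<in> C" "g1 x < ?u x + e"
      using cINF_less_iff[OF ne bdd, of x "?u x + e"] e by auto
    obtain g2 where g2: "g2 \<in> C" "g2 y < ?u y + e"
      using cINF_less_iff[OF ne bdd, of y "?u y + e"] e by auto
    obtain g where g: "g \<in> C" "g \<le> g1" "g \<le> g2"
      using chain[OF g1(1) g2(1)] g1(1) g2(1) by blast
    have "?u ((1 - t) *\<^sub>R x + t *\<^sub>R y) \<le> g ((1 - t) *\<^sub>R x + t *\<^sub>R y)"
      by (rule cINF_lower[OF bdd g(1)])
    also have "\<dots> \<le> (1 - t) * g x + t * g y"
      using convex_onD[OF cvx[OF g(1)]] t by simp
    also have "\<dots> \<le> (1 - t) * (?u x + e) + t * (?u y + e)"
      using g1 g2 le_funD[OF g(2), of x] le_funD[OF g(3), of y] t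
      by (intro add_mono mult_left_mono) auto
    also have "\<dots> = (1 - t) * ?u x + t * ?u y + e"
      by (simp add: algebra_simps)
    finally show "?u ((1 - t) *\<^sub>R x + t *\<^sub>R y) \<le> (1 - t) * ?u x + t * ?u y + e" .
  qed
qed simp

lemma convex_majorant_ereal_iff:
  "convex_majorant f (\<lambda>x. ereal (g x)) \<longleftrightarrow> convex_on UNIV g \<and> f \<le> g"
proof -
  have epi: "ereal_epigraph (\<lambda>x. ereal (g x)) = epigraph UNIV g"
    by (auto simp: ereal_epigraph_def epigraph_def)
  have "(undefined, g undefined) \<in> epigraph UNIV g"
    by (simp add: epigraph_def)
  then have "epigraph UNIV g \<noteq> {}"
    by blast
  then show ?thesis
    by (auto simp: convex_majorant_def convex_ereal_fun_def epi convex_epigraph le_fun_def)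
qed

text \<open>Minimality quantifies over extended-valued competitors. Convexity excludes the value
  \<open>-\<infinity>\<close> and the bound \<open>g\<close> excludes \<open>\<infinity>\<close>, so
  only real competitors remain.\<close>

lemma convex_majorant_le_realE:
  assumes "convex_majorant f h" "h \<le> (\<lambda>x. ereal (g x))"
  obtains h' where "h = (\<lambda>x. ereal (h' x))"
proof
  have "\<bar>h x\<bar> \<noteq> \<infinity>" for x
    using assms(1) le_funD[OF assms(2), of x]
    by (auto simp: convex_majorant_def convex_ereal_fun_def dest: spec[of _ x])
  then show "h = (\<lambda>x. ereal (real_of_ereal (h x)))"
    by (simp add: ereal_real')
qed

lemma ex_minimal_convex_majorant_le:
  fixes f \<phi> :: "'a::real_vector \<Rightarrow> real"
  assumes \<phi>: "convex_on UNIV \<phi>" "f \<le> \<phi>"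
  obtains g where "minimal_convex_majorant f (\<lambda>x. ereal (g x))" "convex_on UNIV g" "g \<le> \<phi>"
proof -
  \<comment> \<open>The ceiling \<phi> keeps the minimal element below \<phi>. It does not weaken
    minimality, since a convex majorant below a member of \<open>A\<close> is again in
    \<open>A\<close>.\<close>
  define A where "A = {g. convex_on UNIV g \<and> f \<le> g \<and> g \<le> \<phi>}"
  have "\<exists>m\<in>A. \<forall>a\<in>A. a \<le> m \<longrightarrow> a = m"
  \<comment> \<open>The order is reversed, so that maximal elements are minimal majorants and chains
    need lower bounds.\<close>
  proof (rule predicate_Zorn[where P = "\<lambda>a b. b \<le> a"])
    show "partial_order_on A (relation_of (\<lambda>a b. b \<le> a) A)"
      by (rule partial_order_on_relation_ofI) auto
  next
    fix C
    assume C: "C \<in> Chains (relation_of (\<lambda>a b. b \<le> a) A)"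
    then have chain: "g \<le> h \<or> h \<le> g" if "g \<in> C" "h \<in> C" for g h
      using that by (auto simp: Chains_def relation_of_def)
    have CA: "C \<subseteq> A"
      using C by (auto simp: Chains_def relation_of_def)
    show "\<exists>u\<in>A. \<forall>a\<in>C. u \<le> a"
    \<comment> \<open>A real infimum over the empty family is meaningless; there \<phi> itself
      serves as the bound. Otherwise \<open>f\<close> bounds the chain from below, so the pointwise
      infimum is genuine.\<close>
    proof (cases "C = {}")
      case True
      then show ?thesis
        using \<phi> by (auto simp: A_def)
    next
      case False
      let ?u = "\<lambda>x. INF g\<in>C. g x"
      have lower: "f x \<le> g x" if "g \<in> C" for g x
        using that CA by (auto simp: A_def le_fun_def)
      have bdd: "bdd_below ((\<lambda>g. g x) ` C)" for x
        using lower by (intro bdd_belowI2)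
      have below: "?u \<le> g" if "g \<in> C" for g
        using that by (auto simp: le_fun_def intro: cINF_lower[OF bdd])
      have "convex_on UNIV ?u"
        using False chain bdd CA by (intro convex_on_INF_chain) (auto simp: A_def)
      moreover have "f \<le> ?u"
        using False lower by (auto simp: le_fun_def intro: cINF_greatest)
      moreover have "?u \<le> \<phi>"
      proof -
        obtain g where "g \<in> C"
          using False by blast
        then have "g \<le> \<phi>"
          using CA by (auto simp: A_def)
        with below[OF \<open>g \<in> C\<close>] show ?thesis
          by (rule order_trans)
      qed
      ultimately show ?thesis
        using below by (auto simp: A_def)
    qed
  qed
  then obtain m where m: "m \<in> A" and min: "\<And>a. a \<in> A \<Longrightarrow> a \<le> m \<Longrightarrow> a = m"
    by blast
  have "h = (\<lambda>x. ereal (m x))"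
    if h: "convex_majorant f h" "h \<le> (\<lambda>x. ereal (m x))" for h
  proof -
    obtain h' where h': "h = (\<lambda>x. ereal (h' x))"
      using h by (rule convex_majorant_le_realE)
    have "h' \<le> m"
      using h(2) by (simp add: h' le_fun_def)
    moreover have "h' \<in> A"
      using h(1) m \<open>h' \<le> m\<close> by (auto simp: A_def h' convex_majorant_ereal_iff)
    ultimately show ?thesis
      using min h' by blast
  qed
  then have "minimal_convex_majorant f (\<lambda>x. ereal (m x))"
    using m by (auto simp: minimal_convex_majorant_def convex_majorant_ereal_iff A_def)
  then show thesis
    using that m by (auto simp: A_def)
qed

theorem theorem4p5:
  fixes f :: "'a::real_normed_vector \<Rightarrow> real"
  shows "Sigma_Lip_plus f \<noteq> {} \<longleftrightarrow> lipschitz_bounded_above f"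
proof
  \<comment> \<open>Any member is itself a Lipschitz function above \<open>f\<close>.\<close>
  assume "Sigma_Lip_plus f \<noteq> {}"
  then show "lipschitz_bounded_above f"
    by (auto simp: Sigma_Lip_plus_def lipschitz_bounded_above_def minimal_convex_majorant_def
        convex_majorant_def)
next
  assume "lipschitz_bounded_above f"
  then obtain \<psi> L where \<psi>: "L-lipschitz_on UNIV \<psi>" "\<And>x. f x \<le> \<psi> x"
    by (auto simp: lipschitz_bounded_above_def lipschitz_fun_def)
  then have L: "0 \<le> L"
    by (simp add: lipschitz_on_nonneg)
  \<comment> \<open>The Lipschitz estimate for \<psi> between \<open>x\<close> and 0 gives
    \<open>\<psi> x \<le> \<phi> x\<close>. Replacing \<psi> by this cone gains convexity, and its
    slope \<open>L\<close> becomes the Lipschitz constant of the minimal majorant.\<close>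
  define \<phi> :: "'a \<Rightarrow> real" where "\<phi> x = \<psi> 0 + L * norm x" for x
  have "f x \<le> \<phi> x" for x
    using \<psi>(2)[of x] lipschitz_onD[OF \<psi>(1), of x 0] by (auto simp: \<phi>_def dist_real_def)
  moreover have "convex_on UNIV (\<lambda>x::'a. norm x)"
    using convex_on_dist[of UNIV "0::'a"] by simp
  then have "convex_on UNIV \<phi>"
    unfolding \<phi>_def using L by (intro convex_on_add convex_on_cmul) (auto simp: convex_on_const)
  ultimately obtain g where g: "minimal_convex_majorant f (\<lambda>x. ereal (g x))"
      "convex_on UNIV g" "g \<le> \<phi>"
    by (metis ex_minimal_convex_majorant_le le_funI)
  have "L-lipschitz_on UNIV g"
    using g(2,3) L by (intro lipschitz_on_of_convex_le_norm[where c = "\<psi> 0"]) (auto simp: \<phi>_def le_fun_def)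
  with g(1) show "Sigma_Lip_plus f \<noteq> {}"
    by (auto simp: Sigma_Lip_plus_def lipschitz_fun_def)
qed

end
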